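(* Consider the Two-Stage Robust Matching Bottleneck problem (TSRMB) with implicit scenarios given by the budget of uncertainty set $\mathcal{S}=\{S\subseteq R_2:|S|\le k\}$, with $n=|R_2|$ and surplus $\ell=|D|-|R_1|-k\ge0$. Suppose $k\le\sqrt{n/2}$ and $\ell<k$, and let $OPT_1$ and $OPT_2$ be the first-stage and second-stage costs of an optimal solution. Then the small-surplus algorithm yields a solution $D_1$ with total cost $$f(D_1)\le 3\,OPT_1+17\,OPT_2 .$$
   Context: TSRMB: an instance consists of a set $D$ of drivers, a set $R_1$ of first-stage riders ($m=|R_1|$), a set $R_2$ of potential second-stage riders ($n=|R_2|$), a family $\mathcal{S}$ of subsets of $R_2$ (scenarios), and a metric distance $d$ on $V=R_1\cup R_2\cup D$. A feasible solution is a set $D_1\subseteq D$ with $|D_1|=|R_1|$. Define $cost_1(D_1,R_1)=\frac1m\sum_{(i,j)\in M_1}d(i,j)$, where $M_1$ is a minimum-weight perfect matching between $R_1$ and $D_1$. For a set of drivers $A$ and a set of riders $S$, $cost_2(A,S)$ is the bottleneck matching cost: the minimum, over all matchings between $A$ and $S$ covering every element of $S$, of the largest distance $d(i,j)$ of a matched pair ($0$ if $S=\emptyset$). The objective is to minimize $f(D_1)=cost_1(D_1,R_1)+\max_{S\in\mathcal{S}}cost_2(D\setminus D_1,S)$. For an optimal solution $D_1^*$, $OPT_1=cost_1(D_1^*,R_1)$, $OPT_2=\max_{S\in\mathcal{S}}cost_2(D\setminus D_1^*,S)$, $OPT=OPT_1+OPT_2$. TSRMB-1-Scenario$(R_1,S,D)$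 denotes an optimal solution of the single-scenario problem $\min_{D_1\subseteq D,\,|D_1|=|R_1|}\{cost_1(D_1,R_1)+cost_2(D\setminus D_1,S)\}$ (computable exactly in polynomial time). Small-surplus algorithm (input $R_1,R_2,k,D$): (1) For a driver $\delta'\in D$ let $R_k(\delta')$ be the set of the $k$ closest second-stage riders to $\delta'$; let $\delta\in D$ be a driver minimizing $\max_{r\in R_k(\delta')}d(\delta',r)$ over $\delta'\in D$. (2) Let $S_1=R_k(\delta)$ be the closest $k$ second-stage riders to $\delta$. (3) Let $S_2=\{o_1,\dots,o_\ell\}$ be the farthest $\ell$ second-stage riders from $\delta$, with $d(\delta,o_1)\ge d(\delta,o_2)\ge\dots\ge d(\delta,o_\ell)$. (4) For $j=0,\dots,\ell$ let $D_1(j)=$ TSRMB-1-Scenario$(R_1,S_1\cup\{o_1,\dots,o_j\},D)$. (5) Return the $D_1(j)$, $j\in\{0,\dots,\ell\}$, minimizing $cost_1(D_1(j),R_1)+\max_{S\in\{S_1,S_2\}}cost_2(D\setminus D_1(j),S)$. *)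

theory Defs
  imports "HOL-Analysis.Abstract_Metric_Spaces"
begin

text \<open>A matching is a set of pairs (rider, driver); no vertex occurs in two of its pairs.\<close>

definition matching :: "'v set \<Rightarrow> 'v set \<Rightarrow> ('v \<times> 'v) set \<Rightarrow> bool" where
  "matching R A M \<longleftrightarrow> M \<subseteq> R \<times> A \<and> inj_on fst M \<and> inj_on snd M"

definition perfect_matching :: "'v set \<Rightarrow> 'v set \<Rightarrow> ('v \<times> 'v) set \<Rightarrow> bool" where
  "perfect_matching R A M \<longleftrightarrow> matching R A M \<and> fst ` M = R \<and> snd ` M = A"

definition weight :: "('v \<Rightarrow> 'v \<Rightarrow> real) \<Rightarrow> ('v \<times> 'v) set \<Rightarrow> real" where
  "weight d M = (\<Sum>(i, j)\<in>M. d i j)"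

definition cost1 :: "('v \<Rightarrow> 'v \<Rightarrow> real) \<Rightarrow> 'v set \<Rightarrow> 'v set \<Rightarrow> real" where
  "cost1 d D1 R1 = 1 / real (card R1) * weight d (ARG_MIN (weight d) M. perfect_matching R1 D1 M)"

text \<open>Meaningful only if \<open>A\<close> and \<open>S\<close> are finite with \<open>card S \<le> card A\<close>; otherwise the
  minimum may range over an empty set and is unspecified.\<close>

definition cost2 :: "('v \<Rightarrow> 'v \<Rightarrow> real) \<Rightarrow> 'v set \<Rightarrow> 'v set \<Rightarrow> real" where
  "cost2 d A S =
    (if S = {} then 0
     else Min {Max {d i j | i j. (i, j) \<in> M} | M. matching S A M \<and> fst ` M = S})"

definition feasible :: "'v set \<Rightarrow> 'v set \<Rightarrow> 'v set \<Rightarrow> bool" where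
  "feasible R1 D D1 \<longleftrightarrow> D1 \<subseteq> D \<and> card D1 = card R1"

definition worst_cost2 ::
  "('v \<Rightarrow> 'v \<Rightarrow> real) \<Rightarrow> 'v set set \<Rightarrow> 'v set \<Rightarrow> 'v set \<Rightarrow> real" where
  "worst_cost2 d \<S> D D1 = Max ((\<lambda>S. cost2 d (D - D1) S) ` \<S>)"

definition total_cost ::
  "('v \<Rightarrow> 'v \<Rightarrow> real) \<Rightarrow> 'v set \<Rightarrow> 'v set set \<Rightarrow> 'v set \<Rightarrow> 'v set \<Rightarrow> real" where
  "total_cost d R1 \<S> D D1 = cost1 d D1 R1 + worst_cost2 d \<S> D D1"

definition optimal_solution ::
  "('v \<Rightarrow> 'v \<Rightarrow> real) \<Rightarrow> 'v set \<Rightarrow> 'v set set \<Rightarrow> 'v set \<Rightarrow> 'v set \<Rightarrow> bool" where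
  "optimal_solution d R1 \<S> D D1 \<longleftrightarrow> is_arg_min (total_cost d R1 \<S> D) (feasible R1 D) D1"

definition budget_scenarios :: "'v set \<Rightarrow> nat \<Rightarrow> 'v set set" where
  "budget_scenarios R2 k = {S. S \<subseteq> R2 \<and> card S \<le> k}"

definition one_scenario_solution ::
  "('v \<Rightarrow> 'v \<Rightarrow> real) \<Rightarrow> 'v set \<Rightarrow> 'v set \<Rightarrow> 'v set \<Rightarrow> 'v set \<Rightarrow> bool" where
  "one_scenario_solution d R1 S D D1 \<longleftrightarrow>
    is_arg_min (\<lambda>D1. cost1 d D1 R1 + cost2 d (D - D1) S) (feasible R1 D) D1"

text \<open>Natural subtraction: the true surplus only if \<open>card R1 + k \<le> card D\<close>.\<close>

definition surplus :: "'v set \<Rightarrow> nat \<Rightarrow> 'v set \<Rightarrow> nat" where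
  "surplus R1 k D = card D - card R1 - k"

definition closest_riders ::
  "('v \<Rightarrow> 'v \<Rightarrow> real) \<Rightarrow> 'v set \<Rightarrow> nat \<Rightarrow> 'v \<Rightarrow> 'v set \<Rightarrow> bool" where
  "closest_riders d R2 k \<delta> S \<longleftrightarrow>
    S \<subseteq> R2 \<and> card S = k \<and> (\<forall>r\<in>S. \<forall>r'\<in>R2 - S. d \<delta> r \<le> d \<delta> r')"

definition farthest_riders_list ::
  "('v \<Rightarrow> 'v \<Rightarrow> real) \<Rightarrow> 'v set \<Rightarrow> nat \<Rightarrow> 'v \<Rightarrow> 'v list \<Rightarrow> bool" where
  "farthest_riders_list d R2 l \<delta> os \<longleftrightarrow>
    set os \<subseteq> R2 \<and> distinct os \<and> length os = l \<and>
    (\<forall>r\<in>set os. \<forall>r'\<in>R2 - set os. d \<delta> r \<ge> d \<delta> r') \<and>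
    sorted_wrt (\<lambda>r r'. d \<delta> r \<ge> d \<delta> r') os"

text \<open>The algorithm leaves open how ties are broken and which optimal single-scenario solutions
  are used, so it is a relation: \<open>small_surplus_output d R1 R2 k D D1\<close> says that some run
  returns \<open>D1\<close>. The list \<open>os\<close> is \<open>[o\<^sub>1, \<dots>, o\<^sub>l]\<close>.\<close>

definition small_surplus_output ::
  "('v \<Rightarrow> 'v \<Rightarrow> real) \<Rightarrow> 'v set \<Rightarrow> 'v set \<Rightarrow> nat \<Rightarrow> 'v set \<Rightarrow> 'v set \<Rightarrow> bool" where
  "small_surplus_output d R1 R2 k D D1 \<longleftrightarrow>
    (\<exists>Rk \<delta> S1 os S2 Dsol j.
      (\<forall>\<delta>'\<in>D. closest_riders d R2 k \<delta>' (Rk \<delta>')) \<and>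
      is_arg_min (\<lambda>\<delta>'. Max ((\<lambda>r. d \<delta>' r) ` Rk \<delta>')) (\<lambda>\<delta>'. \<delta>' \<in> D) \<delta> \<and>
      S1 = Rk \<delta> \<and>
      farthest_riders_list d R2 (surplus R1 k D) \<delta> os \<and> S2 = set os \<and>
      (\<forall>i\<le>surplus R1 k D. one_scenario_solution d R1 (S1 \<union> set (take i os)) D (Dsol i)) \<and>
      is_arg_min (\<lambda>i. cost1 d (Dsol i) R1 + worst_cost2 d {S1, S2} D (Dsol i))
        (\<lambda>i. i \<le> surplus R1 k D) j \<and>
      D1 = Dsol j)"

end

theory Submission
  imports Defs
begin

text \<open>
  Write \<open>T\<close> for \<open>OPT2\<close>. The fewer than \<open>2k\<close> drivers kept for the second stage by an optimal
  solution reach each of the \<open>n \<ge> 2k\<^sup>2\<close> riders within \<open>T\<close> (singleton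
  scenarios), so one of them has \<open>k\<close> riders within \<open>T\<close>; hence \<open>S1\<close> lies within \<open>T\<close> of \<open>\<delta>\<close>. Call a rider far if its distance from \<open>\<delta>\<close> exceeds \<open>3T\<close>.
  In the optimal solution, drivers serving far riders are never those serving \<open>S1\<close>, so at most
  \<open>l\<close> riders are far, they form a prefix of \<open>S2\<close>, and together with \<open>S1\<close> they are served
  within \<open>T\<close>. The iteration with that prefix therefore has value at most \<open>OPT1 + 5T\<close>, because near
  riders can use the drivers of \<open>S1\<close> at an extra cost of \<open>4T\<close>. The same rerouting bounds the cost of
  any scenario by the cost of \<open>{S1, S2}\<close> plus \<open>4T\<close>, which even gives \<open>OPT1 + 9T\<close>.
\<close>

section \<open>Bottleneck cost expressed through injective assignments\<close>

definition serves :: "('v \<Rightarrow> 'v \<Rightarrow> real) \<Rightarrow> real \<Rightarrow> 'v set \<Rightarrow> 'v set \<Rightarrow> ('v \<Rightarrow> 'v) \<Rightarrow> bool" where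
  "serves d c A S f \<longleftrightarrow> inj_on f S \<and> f ` S \<subseteq> A \<and> (\<forall>s\<in>S. d s (f s) \<le> c)"

lemma serves_mono:
  assumes "serves d c A S f" "c \<le> c'" "S' \<subseteq> S"
  shows "serves d c' A S' f"
  using assms unfolding serves_def by (auto intro: inj_on_subset) force

lemma matching_of_inj:
  assumes "inj_on f S" "f ` S \<subseteq> A"
  shows "matching S A ((\<lambda>s. (s, f s)) ` S)" "fst ` (\<lambda>s. (s, f s)) ` S = S"
  using assms unfolding matching_def by (auto simp: inj_on_def image_image)

text \<open>There are finitely many covering matchings, and the cardinality bound provides at least
  one, so the \<open>Min\<close> is attained; such a matching is the graph of an injective function.
  The condition on \<open>c\<close> for empty \<open>S\<close> reflects the default value 0.
  Functions, unlike sets of pairs, are easy to restrict and glue later.\<close>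

lemma cost2_le_iff:
  assumes "finite A" "finite S" "card S \<le> card A" "S = {} \<Longrightarrow> 0 \<le> c"
  shows "cost2 d A S \<le> c \<longleftrightarrow> (\<exists>f. serves d c A S f)"
proof (cases "S = {}")
  case True
  then show ?thesis using assms by (simp add: cost2_def serves_def)
next
  case False
  define \<M> where "\<M> = {M. matching S A M \<and> fst ` M = S}"
  define b where "b M = Max {d i j | i j. (i, j) \<in> M}" for M
  have cost: "cost2 d A S = Min (b ` \<M>)"
    using False by (simp add: cost2_def \<M>_def b_def image_def Collect_conj_eq)
      (rule arg_cong[where f = Min], blast)
  have sub: "\<M> \<subseteq> Pow (S \<times> A)" by (auto simp: \<M>_def matching_def)
  then have fin: "finite \<M>" using assms by (meson finite_Pow_iff finite_SigmaI finite_subset)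
  have b_le: "b M \<le> c \<longleftrightarrow> (\<forall>(i, j)\<in>M. d i j \<le> c)" if "M \<in> \<M>" for M
  proof -
    have "finite M" using sub that assms by (meson Pow_iff finite_SigmaI finite_subset subsetD)
    moreover have "M \<noteq> {}" using that False by (auto simp: \<M>_def)
    moreover have "{d i j | i j. (i, j) \<in> M} = (\<lambda>(i, j). d i j) ` M" by force
    ultimately show ?thesis unfolding b_def by (auto simp: Max_le_iff)
  qed
  obtain g where "g ` S \<subseteq> A" "inj_on g S" using card_le_inj[OF assms(2,1,3)] by blast
  then have ne: "\<M> \<noteq> {}" using matching_of_inj[of g S A] by (auto simp: \<M>_def)
  have "cost2 d A S \<le> c \<longleftrightarrow> (\<exists>M\<in>\<M>. \<forall>(i, j)\<in>M. d i j \<le> c)"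
    using cost fin ne b_le by (simp add: Min_le_iff)
  also have "\<dots> \<longleftrightarrow> (\<exists>f. serves d c A S f)"
  proof
    assume "\<exists>M\<in>\<M>. \<forall>(i, j)\<in>M. d i j \<le> c"
    then obtain M where M: "M \<subseteq> S \<times> A" "inj_on snd M" "fst ` M = S"
      and le: "\<forall>(i, j)\<in>M. d i j \<le> c"
      by (auto simp: \<M>_def matching_def)
    have "\<forall>s\<in>S. \<exists>a. (s, a) \<in> M" using M(3) by force
    then obtain f where f: "\<forall>s\<in>S. (s, f s) \<in> M" by metis
    have "inj_on f S"
    proof (rule inj_onI)
      fix x y assume "x \<in> S" "y \<in> S" "f x = f y"
      then show "x = y" using inj_onD[OF M(2), of "(x, f x)" "(y, f y)"] f
        by (metis prod.inject snd_conv)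
    qed
    then show "\<exists>f. serves d c A S f" using f M(1) le unfolding serves_def by blast
  next
    assume "\<exists>f. serves d c A S f"
    then obtain f where f: "serves d c A S f" ..
    then have "(\<lambda>s. (s, f s)) ` S \<in> \<M>"
      using matching_of_inj[of f S A] by (simp add: \<M>_def serves_def)
    then show "\<exists>M\<in>\<M>. \<forall>(i, j)\<in>M. d i j \<le> c"
      using f by (intro bexI[of _ "(\<lambda>s. (s, f s)) ` S"]) (auto simp: serves_def)
  qed
  finally show ?thesis .
qed

lemma obtain_cost2_serves:
  assumes "finite A" "finite S" "card S \<le> card A"
  obtains f where "serves d (cost2 d A S) A S f"
proof -
  have "S = {} \<Longrightarrow> 0 \<le> cost2 d A S" by (simp add: cost2_def)
  then show thesis using cost2_le_iff[OF assms] that by blast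
qed

lemma cost2_le:
  assumes "finite A" "finite S" "card S \<le> card A" "0 \<le> c" "serves d c A S f"
  shows "cost2 d A S \<le> c"
  using cost2_le_iff[OF assms(1-3)] assms(4,5) by blast

lemma cost2_nonneg:
  assumes "\<And>x y. 0 \<le> d x y" "finite A" "finite S" "card S \<le> card A"
  shows "0 \<le> cost2 d A S"
proof (cases "S = {}")
  case False
  then obtain s where "s \<in> S" by blast
  obtain f where "serves d (cost2 d A S) A S f" using obtain_cost2_serves assms(2-4) by blast
  then have "d s (f s) \<le> cost2 d A S" using \<open>s \<in> S\<close> by (simp add: serves_def)
  then show ?thesis using assms(1) by (meson order_trans)
qed (simp add: cost2_def)

lemma cost1_nonneg:
  assumes "\<And>x y. 0 \<le> d x y"
  shows "0 \<le> cost1 d D1 R1"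
  unfolding cost1_def weight_def
  by (intro mult_nonneg_nonneg sum_nonneg) (auto simp: assms)

section \<open>Rerouting through free drivers, and pigeonhole counting\<close>

lemma disjoint_inj_exists:
  assumes "finite N" "finite B" "finite F" "card N + card F \<le> card B"
  obtains \<phi> where "inj_on \<phi> N" "\<phi> ` N \<subseteq> B - F"
proof -
  have "card N \<le> card (B - F)" using assms diff_card_le_card_Diff[of F B] by linarith
  then show thesis using card_le_inj[of N "B - F"] assms that by blast
qed

text \<open>Riders of \<open>N\<close> are rerouted through riders of \<open>S\<close> to those drivers of \<open>S\<close> that \<open>F\<close> leaves free.\<close>
lemma serves_reroute:
  assumes "Metric_space V d" "S \<union> N \<union> A \<subseteq> V" "finite S" "finite F" "finite N"
    and "F \<inter> N = {}" "card N + card F \<le> card S" "0 \<le> e"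
    and g: "serves d c A F g" and h: "serves d c A S h"
    and near: "\<And>r s. r \<in> N \<Longrightarrow> s \<in> S \<Longrightarrow> d r s \<le> e"
  shows "\<exists>f. serves d (c + e) A (F \<union> N) f"
proof -
  have card_h: "card (h ` S) = card S" using h by (simp add: serves_def card_image)
  have "card (g ` F) \<le> card F" using \<open>finite F\<close> by (rule card_image_le)
  \<comment> \<open>\<open>h\<close> uses exactly \<open>card S\<close> distinct drivers and
    \<open>g\<close> blocks at most \<open>card F\<close> of them, so enough remain free for
    \<open>N\<close>.\<close>
  then have "card N + card (g ` F) \<le> card (h ` S)" using assms(7) card_h by linarith
  then obtain \<phi> where \<phi>: "inj_on \<phi> N" "\<phi> ` N \<subseteq> h ` S - g ` F"
    using disjoint_inj_exists[of N "h ` S" "g ` F"] assms(3-5) by blast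
  define f where "f r = (if r \<in> F then g r else \<phi> r)" for r
  have fN: "f r = \<phi> r" if "r \<in> N" for r using that assms(6) by (auto simp: f_def)
  have fF: "f r = g r" if "r \<in> F" for r using that by (simp add: f_def)
  have images: "f ` F = g ` F" "f ` N = \<phi> ` N" by (simp_all add: fF fN)
  have "inj_on f F \<longleftrightarrow> inj_on g F" "inj_on f N \<longleftrightarrow> inj_on \<phi> N"
    by (rule inj_on_cong, simp add: fF, rule inj_on_cong, simp add: fN)
  then have "inj_on f F" "inj_on f N" using g \<phi>(1) by (simp_all add: serves_def)
  moreover have "f ` F \<inter> f ` N = {}" unfolding images using \<phi>(2) by blast
  then have "f ` (F - N) \<inter> f ` (N - F) = {}" by blast
  ultimately have "inj_on f (F \<union> N)" by (simp add: inj_on_Un)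
  moreover have gA: "g ` F \<subseteq> A" and hA: "h ` S \<subseteq> A" using g h by (simp_all add: serves_def)
  have "\<phi> ` N \<subseteq> A" using \<phi>(2) hA by (meson Diff_subset order_trans)
  with gA have "f ` (F \<union> N) \<subseteq> A" by (simp add: image_Un images)
  moreover have "d r (f r) \<le> c + e" if "r \<in> F \<union> N" for r
  proof (cases "r \<in> F")
    case True
    then have "d r (f r) \<le> c" using g fF by (simp add: serves_def)
    then show ?thesis using \<open>0 \<le> e\<close> by linarith
  next
    case False
    then have "r \<in> N" using that by simp
    then have "f r \<in> h ` S" using \<phi>(2) fN[of r] by auto
    then obtain s where s: "s \<in> S" "f r = h s" by blast
    then have "h s \<in> A" "d s (h s) \<le> c" using h by (auto simp: serves_def)
    \<comment> \<open>The detour from \<open>r\<close> to the rider \<open>s\<close> costs at most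
      \<open>e\<close>, and the onward way to the driver of \<open>s\<close> at most
      \<open>c\<close>.\<close>
    then have "d r (h s) \<le> d r s + d s (h s)"
      using Metric_space.triangle[OF assms(1)] assms(2) s \<open>r \<in> N\<close> by blast
    then show ?thesis using near[OF \<open>r \<in> N\<close> s(1)] \<open>d s (h s) \<le> c\<close> s(2) by simp
  qed
  ultimately show ?thesis unfolding serves_def by blast
qed

text \<open>Fibres of size at most \<open>k - 1\<close> over \<open>A\<close> could cover only
  \<open>card A * (k - 1)\<close> elements of \<open>R\<close>.\<close>

lemma pigeonhole_fibre:
  assumes "finite R" "finite A" "g ` R \<subseteq> A" "card A * (k - 1) < card R"
  shows "\<exists>p\<in>A. k \<le> card {r \<in> R. g r = p}"
proof (rule ccontr)
  assume "\<not> ?thesis"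
  then have lt: "card {r \<in> R. g r = p} \<le> k - 1" if "p \<in> A" for p using that by force
  have "R = (\<Union>p\<in>A. {r \<in> R. g r = p})" using assms by auto
  then have "card R \<le> (\<Sum>p\<in>A. card {r \<in> R. g r = p})" using card_UN_le[OF assms(2)] by metis
  also have "\<dots> \<le> card A * (k - 1)" using sum_bounded_above[of A _ "k - 1"] lt by fastforce
  finally show False using assms by simp
qed

section \<open>Sorted lists and existence of a run of the algorithm\<close>

lemma obtain_sorted_prefix:
  fixes key :: "'a \<Rightarrow> 'b::linorder"
  assumes "finite A" "l \<le> card A"
  obtains xs where "set xs \<subseteq> A" "distinct xs" "length xs = l"
    "\<forall>r\<in>set xs. \<forall>r'\<in>A - set xs. key r \<le> key r'"
    "sorted_wrt (\<lambda>r r'. key r \<le> key r') xs"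
proof -
  obtain zs where zs: "set zs = A" "distinct zs" using finite_distinct_list[OF assms(1)] by blast
  define ys where "ys = sort_key key zs"
  have ys: "set ys = A" "distinct ys" "length ys = card A"
    using zs distinct_card[of zs] by (auto simp: ys_def)
  have "sorted_wrt (\<lambda>r r'. key r \<le> key r') (take l ys @ drop l ys)"
    using sorted_sort_key[of key zs] by (simp add: ys_def sorted_map)
  then have "sorted_wrt (\<lambda>r r'. key r \<le> key r') (take l ys)"
    "\<forall>r\<in>set (take l ys). \<forall>r'\<in>set (drop l ys). key r \<le> key r'"
    unfolding sorted_wrt_append by auto
  moreover have "A - set (take l ys) \<subseteq> set (drop l ys)"
    using ys(1) by (metis Diff_subset_conv append_take_drop_id set_append subset_refl)
  moreover have "set (take l ys) \<subseteq> A" using ys(1) set_take_subset by fastforce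
  ultimately show thesis using that[of "take l ys"] ys assms(2) by auto
qed

text \<open>Along a nonincreasing list the threshold test never succeeds again after failing once.
  This is what makes the far riders a prefix of the list of farthest riders.\<close>

lemma set_takeWhile_antimono:
  assumes "sorted_wrt (\<lambda>x y. f x \<ge> f y) xs"
  shows "set (takeWhile (\<lambda>x. (t::real) < f x) xs) = {x \<in> set xs. t < f x}"
  using assms by (induction xs) auto

lemma finite_feasible: "finite D \<Longrightarrow> finite {D1. feasible R1 D D1}"
  by (rule finite_subset[of _ "Pow D"]) (auto simp: feasible_def)

lemma ex_is_arg_min:
  fixes f :: "'a \<Rightarrow> 'b::linorder"
  assumes "finite {x. P x}" "P a"
  obtains x where "is_arg_min f P x"
  using ex_is_arg_min_if_finite[of "{x. P x}" f] assms by auto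

text \<open>Shows that a bound on all outputs is not vacuous: every selection is a sorted prefix or
  a minimizer over a finite nonempty set.\<close>

lemma small_surplus_output_exists:
  assumes fin: "finite R2" "finite D" and "card R1 + k \<le> card D" "0 < k"
    and "k \<le> card R2" "surplus R1 k D \<le> card R2"
  obtains D1 where "small_surplus_output d R1 R2 k D D1"
proof -
  define l where "l = surplus R1 k D"
  have "\<exists>S. closest_riders d R2 k \<delta> S" for \<delta>
  proof -
    obtain xs where "set xs \<subseteq> R2" "distinct xs" "length xs = k"
      "\<forall>r\<in>set xs. \<forall>r'\<in>R2 - set xs. d \<delta> r \<le> d \<delta> r'"
      using obtain_sorted_prefix[OF fin(1) assms(5), of "d \<delta>"] by blast
    then show ?thesis
      by (intro exI[of _ "set xs"]) (auto simp: closest_riders_def distinct_card)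
  qed
  then obtain Rk where Rk: "\<And>\<delta>. closest_riders d R2 k \<delta> (Rk \<delta>)" by metis
  have "D \<noteq> {}" using assms by auto
  then obtain a where "a \<in> D" by blast
  then obtain \<delta> where \<delta>: "is_arg_min (\<lambda>\<delta>'. Max ((\<lambda>r. d \<delta>' r) ` Rk \<delta>')) (\<lambda>\<delta>'. \<delta>' \<in> D) \<delta>"
    using ex_is_arg_min[of "\<lambda>\<delta>'. \<delta>' \<in> D" a] fin(2) by (metis Collect_mem_eq)
  \<comment> \<open>Negating the distance turns the ascending order into farthest first.\<close>
  obtain os where "set os \<subseteq> R2" "distinct os" "length os = l"
      "\<forall>r\<in>set os. \<forall>r'\<in>R2 - set os. - d \<delta> r \<le> - d \<delta> r'"
      "sorted_wrt (\<lambda>r r'. - d \<delta> r \<le> - d \<delta> r') os"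
    by (rule obtain_sorted_prefix[OF fin(1) assms(6)[folded l_def], of "\<lambda>r. - d \<delta> r"])
  then have os: "farthest_riders_list d R2 l \<delta> os" by (simp add: farthest_riders_list_def)
  obtain D0 where "D0 \<subseteq> D" "card D0 = card R1"
    using obtain_subset_with_card_n[OF add_leD1[OF assms(3)]] by blast
  then have "feasible R1 D D0" by (simp add: feasible_def)
  then have "\<exists>D1. one_scenario_solution d R1 S D D1" for S
    unfolding one_scenario_solution_def
    using ex_is_arg_min[OF finite_feasible[OF fin(2)] \<open>feasible R1 D D0\<close>] by blast
  then obtain sol where sol: "\<And>S. one_scenario_solution d R1 S D (sol S)" by metis
  define Dsol where "Dsol i = sol (Rk \<delta> \<union> set (take i os))" for i
  obtain j where "is_arg_min (\<lambda>i. cost1 d (Dsol i) R1 + worst_cost2 d {Rk \<delta>, set os} D (Dsol i))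
      (\<lambda>i. i \<le> l) j"
    using ex_is_arg_min[of "\<lambda>i. i \<le> l" 0] finite_Collect_le_nat by blast
  then have "small_surplus_output d R1 R2 k D (Dsol j)"
    unfolding small_surplus_output_def using Rk \<delta> os sol
    by (intro exI[of _ Rk] exI[of _ \<delta>] exI[of _ "Rk \<delta>"] exI[of _ os] exI[of _ "set os"]
        exI[of _ Dsol] exI[of _ j]) (simp add: Dsol_def l_def)
  then show thesis using that by blast
qed

section \<open>Bounding the cost of the returned solution\<close>

lemma closest_riders_within:
  assumes "finite R2" "closest_riders d R2 k \<delta> S" "k \<le> card {r \<in> R2. d \<delta> r \<le> t}" "s \<in> S"
  shows "d \<delta> s \<le> t"
proof (rule ccontr)
  assume s: "\<not> d \<delta> s \<le> t"
  have S: "S \<subseteq> R2" "card S = k" "\<forall>r\<in>S. \<forall>r'\<in>R2 - S. d \<delta> r \<le> d \<delta> r'"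
    using assms(2) by (auto simp: closest_riders_def)
  \<comment> \<open>Riders outside \<open>S\<close> are at least as far as \<open>s\<close>, hence
    beyond \<open>t\<close>, leaving at most \<open>k - 1\<close> riders within
    \<open>t\<close>.\<close>
  have "{r \<in> R2. d \<delta> r \<le> t} \<subseteq> S - {s}" using s S(3) assms(4) by force
  then have "card {r \<in> R2. d \<delta> r \<le> t} \<le> card (S - {s})"
    using S(1) assms(1) by (meson card_mono finite_Diff finite_subset)
  also have "\<dots> < card S" using S(1) assms(1,4) by (meson card_Diff1_less finite_subset)
  finally show False using S(2) assms(3) by simp
qed

lemma finite_budget_scenarios: "finite R2 \<Longrightarrow> finite (budget_scenarios R2 k)"
  by (rule finite_subset[of _ "Pow R2"]) (auto simp: budget_scenarios_def)

lemma worst_cost2_budget_le_iff: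
  assumes "finite R2"
  shows "worst_cost2 d (budget_scenarios R2 k) D D1 \<le> c \<longleftrightarrow>
    (\<forall>S. S \<subseteq> R2 \<and> card S \<le> k \<longrightarrow> cost2 d (D - D1) S \<le> c)"
proof -
  \<comment> \<open>The empty scenario keeps the family nonempty, so its \<open>Max\<close> is
    specified.\<close>
  have "budget_scenarios R2 k \<noteq> {}" by (auto simp: budget_scenarios_def intro: exI[of _ "{}"])
  then show ?thesis
    unfolding worst_cost2_def using finite_budget_scenarios[OF assms]
    by (auto simp: Max_le_iff) (auto simp: budget_scenarios_def)
qed

lemma small_surplus_bound:
  fixes d :: "'v \<Rightarrow> 'v \<Rightarrow> real"
  assumes fin: "finite R2" "finite D"
    and metric: "Metric_space (R1 \<union> R2 \<union> D) d"
    and card_D: "card R1 + k \<le> card D"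
    and k: "2 * k\<^sup>2 \<le> card R2"
    and surplus: "surplus R1 k D < k"
    and Dopt: "feasible R1 D Dopt"
    and T: "T = worst_cost2 d (budget_scenarios R2 k) D Dopt"
    and out: "small_surplus_output d R1 R2 k D D1"
  shows "feasible R1 D D1"
    and "total_cost d R1 (budget_scenarios R2 k) D D1 \<le> cost1 d Dopt R1 + 9 * T"
proof -
  interpret Metric_space "R1 \<union> R2 \<union> D" d by fact
  define l where "l = surplus R1 k D"
  have lk: "l < k" using surplus by (simp add: l_def)
  \<comment> \<open>\<open>card_D\<close> makes the natural subtraction in \<open>surplus\<close>
    exact.\<close>
  have card_left: "card (D - E) = k + l" if "feasible R1 D E" for E
    using that card_D fin(2) card_Diff_subset[of E D]
    by (auto simp: feasible_def l_def surplus_def intro: finite_subset)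
  define A where "A = D - Dopt"
  have A: "finite A" "A \<subseteq> D" "card A = k + l"
    using fin(2) card_left[OF Dopt] by (auto simp: A_def)
  have cost_T: "cost2 d A S \<le> T" if "S \<subseteq> R2" "card S \<le> k" for S
    using worst_cost2_budget_le_iff[OF fin(1), of d k D Dopt T] T that by (simp add: A_def)
  have T0: "0 \<le> T" using cost_T[of "{}"] by (simp add: cost2_def)
  have serve: "\<exists>f. serves d T A S f" if "S \<subseteq> R2" "card S \<le> k" for S
  proof -
    have "finite S" "card S \<le> card A" using that A(3) fin(1) by (auto intro: finite_subset)
    then obtain f where "serves d (cost2 d A S) A S f" using obtain_cost2_serves A(1) by blast
    then show ?thesis using serves_mono[OF _ cost_T[OF that] order_refl] by blast
  qed
  obtain Rk \<delta> S1 os S2 Dsol j where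
    Rk: "\<And>\<delta>'. \<delta>' \<in> D \<Longrightarrow> closest_riders d R2 k \<delta>' (Rk \<delta>')" and
    \<delta>: "is_arg_min (\<lambda>\<delta>'. Max ((\<lambda>r. d \<delta>' r) ` Rk \<delta>')) (\<lambda>\<delta>'. \<delta>' \<in> D) \<delta>" and
    S1: "S1 = Rk \<delta>" and
    os: "farthest_riders_list d R2 l \<delta> os" and S2: "S2 = set os" and
    Dsol: "\<And>i. i \<le> l \<Longrightarrow> one_scenario_solution d R1 (S1 \<union> set (take i os)) D (Dsol i)" and
    j: "is_arg_min (\<lambda>i. cost1 d (Dsol i) R1 + worst_cost2 d {S1, S2} D (Dsol i)) (\<lambda>i. i \<le> l) j" and
    D1: "D1 = Dsol j"
    using out unfolding small_surplus_output_def l_def by blast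
  have feas: "feasible R1 D (Dsol i)" if "i \<le> l" for i
    using Dsol[OF that] by (simp add: one_scenario_solution_def is_arg_min_def)
  have jl: "j \<le> l" using j by (simp add: is_arg_min_def)
  show feas1: "feasible R1 D D1" using feas[OF jl] D1 by simp
  have \<delta>D: "\<delta> \<in> D" using \<delta> by (simp add: is_arg_min_def)
  have S1_props: "S1 \<subseteq> R2" "card S1 = k" using Rk[OF \<delta>D] S1 by (auto simp: closest_riders_def)
  have S2_props: "S2 \<subseteq> R2" "card S2 = l"
    using os S2 by (auto simp: farthest_riders_list_def distinct_card)
  have finS: "finite S1" "finite S2" using S1_props S2_props fin(1) by (auto intro: finite_subset)

  have "\<exists>a. a \<in> A \<and> d a r \<le> T" if "r \<in> R2" for r
  proof -
    \<comment> \<open>From \<open>l < k\<close> follows that \<open>k\<close> is at least 1, so a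
      singleton is within the budget.\<close>
    have "{r} \<subseteq> R2" "card {r} \<le> k" using that lk by auto
    then obtain f where "serves d T A {r} f" using serve by blast
    then show ?thesis by (intro exI[of _ "f r"]) (auto simp: serves_def commute)
  qed
  then obtain g where g: "\<And>r. r \<in> R2 \<Longrightarrow> g r \<in> A \<and> d (g r) r \<le> T" by metis
  \<comment> \<open>Fewer than \<open>2 * k\<close> drivers with at most \<open>k - 1\<close> riders
    each would reach fewer than \<open>2 * k\<^sup>2\<close> riders; here the bound on
    \<open>k\<close> enters.\<close>
  have "card A * (k - 1) < card R2"
  proof -
    have "card A * (k - 1) \<le> (2 * k) * (k - 1)" using A(3) lk by (intro mult_right_mono) auto
    also have "\<dots> < (2 * k) * k" using lk by (intro mult_strict_left_mono) auto
    finally show ?thesis using k by (simp add: power2_eq_square)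
  qed
  then obtain p where p: "p \<in> A" "k \<le> card {r \<in> R2. g r = p}"
    using pigeonhole_fibre[OF fin(1) A(1), of g k] g by blast
  have "card {r \<in> R2. g r = p} \<le> card {r \<in> R2. d p r \<le> T}"
    using fin(1) g by (intro card_mono) auto
  then have "k \<le> card {r \<in> R2. d p r \<le> T}" using p(2) by simp
  then have p_near: "d p r \<le> T" if "r \<in> Rk p" for r
    using closest_riders_within[OF fin(1) Rk] p(1) A(2) that by blast
  have near_S1: "d \<delta> s \<le> T" if "s \<in> S1" for s
  proof -
    have pD: "p \<in> D" using p(1) A(2) by blast
    have Rkp: "finite (Rk p)" "Rk p \<noteq> {}"
      using Rk[OF pD] fin(1) lk by (auto simp: closest_riders_def intro: finite_subset)
    have "d \<delta> s \<le> Max ((\<lambda>r. d \<delta> r) ` Rk \<delta>)" using that finS S1 by auto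
    \<comment> \<open>\<open>\<delta>\<close> minimizes this radius over all drivers, so it does at
      least as well as \<open>p\<close>.\<close>
    also have "\<dots> \<le> Max ((\<lambda>r. d p r) ` Rk p)"
      using \<delta> pD by (auto simp: is_arg_min_linorder)
    also have "\<dots> \<le> T" using Rkp p_near by simp
    finally show ?thesis .
  qed

  define Far where "Far = {r \<in> R2. 3 * T < d \<delta> r}"
  have Far: "Far \<subseteq> R2" "finite Far" using fin(1) by (auto simp: Far_def)
  obtain h where h: "serves d T A S1 h" using serve S1_props by blast
  \<comment> \<open>A driver shared by \<open>r\<close> and some \<open>s\<close> in
    \<open>S1\<close> would give a path from \<open>\<delta>\<close> via \<open>s\<close> and that
    driver to \<open>r\<close> of length at most \<open>3 * T\<close>, hence the threshold in
    \<open>Far\<close>. The two assignments may come from different scenarios, which allows them to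
    be glued.\<close>
  have disj: "g ` F \<inter> h ` S1 = {}" if "F \<subseteq> Far" "serves d T A F g" for F g
  proof -
    have False if "r \<in> F" "s \<in> S1" "g r = h s" for r s
    proof -
      have *: "r \<in> R2" "3 * T < d \<delta> r" using that(1) \<open>F \<subseteq> Far\<close> by (auto simp: Far_def)
      have "h s \<in> A" "d s (h s) \<le> T" using h that by (auto simp: serves_def)
      moreover have "d r (h s) \<le> T" using \<open>serves d T A F g\<close> that by (auto simp: serves_def)
      moreover have "d \<delta> s \<le> T" using near_S1 that by simp
      moreover have "d \<delta> (h s) \<le> d \<delta> s + d s (h s)"
        using \<open>h s \<in> A\<close> A(2) \<delta>D S1_props(1) that(2) by (intro triangle) auto
      moreover have "d \<delta> r \<le> d \<delta> (h s) + d (h s) r"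
        using \<open>h s \<in> A\<close> A(2) \<delta>D * by (intro triangle) auto
      ultimately show False using * commute[of r "h s"] by linarith
    qed
    then show ?thesis by blast
  qed
  have card_hS1: "card (h ` S1) = k" using h S1_props by (simp add: serves_def card_image)
  have card_Far: "card Far \<le> l"
  proof (rule ccontr)
    assume "\<not> card Far \<le> l"
    \<comment> \<open>Taking exactly \<open>l + 1\<close> far riders stays within the budget, as
      \<open>l < k\<close>, yet with the \<open>k\<close> drivers of \<open>S1\<close> it would need
      one driver more than \<open>A\<close> has.\<close>
    then obtain F where F: "F \<subseteq> Far" "card F = l + 1"
      using obtain_subset_with_card_n[of "l + 1" Far] by auto
    have "F \<subseteq> R2" "card F \<le> k" using F Far lk by auto
    then obtain g where g: "serves d T A F g" using serve by blast
    have "card (g ` F \<union> h ` S1) = l + 1 + k"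
      using disj[OF F(1) g] F g card_hS1 finS finite_subset[OF F(1) Far(2)]
      by (simp add: card_Un_disjoint serves_def card_image)
    moreover have "card (g ` F \<union> h ` S1) \<le> card A"
      using g h A(1) by (intro card_mono) (auto simp: serves_def)
    ultimately show False using A(3) by linarith
  qed
  have Far_S2: "Far \<subseteq> S2"
  proof (rule ccontr)
    assume "\<not> Far \<subseteq> S2"
    then obtain r where r: "r \<in> Far" "r \<notin> S2" by blast
    \<comment> \<open>All of \<open>S2\<close> is at least as far as the omitted \<open>r\<close>,
      which would make \<open>l + 1\<close> far riders.\<close>
    then have "insert r S2 \<subseteq> Far"
      using os S2 S2_props(1) unfolding farthest_riders_list_def Far_def by force
    then have "card (insert r S2) \<le> card Far" using Far(2) by (rule card_mono[rotated])
    then show False using card_Far r(2) finS S2_props by simp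
  qed
  \<comment> \<open>The witness iteration: cutting \<open>os\<close> at the last far rider makes its
    scenario exactly \<open>S1 \<union> Far\<close>.\<close>
  define i where "i = length (takeWhile (\<lambda>r. 3 * T < d \<delta> r) os)"
  have il: "i \<le> l" using os length_takeWhile_le by (auto simp: i_def farthest_riders_list_def)
  have prefix: "set (take i os) = Far"
  proof -
    have "take i os = takeWhile (\<lambda>r. 3 * T < d \<delta> r) os" by (simp add: i_def takeWhile_eq_take[symmetric])
    then have "set (take i os) = {r \<in> set os. 3 * T < d \<delta> r}"
      using set_takeWhile_antimono[of "d \<delta>" os "3 * T"] os by (simp add: farthest_riders_list_def)
    then show ?thesis using Far_S2 S2 S2_props(1) by (auto simp: Far_def)
  qed

  \<comment> \<open>\<open>3 * T\<close> from \<open>r\<close> to \<open>\<delta>\<close> plus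
    \<open>T\<close> from \<open>\<delta>\<close> to \<open>s\<close>.\<close>
  have near: "d r s \<le> 4 * T" if "r \<in> R2 - Far" "s \<in> S1" for r s
  proof -
    have "d r s \<le> d r \<delta> + d \<delta> s" using that \<delta>D S1_props by (intro triangle) auto
    then show ?thesis using that near_S1[of s] commute[of r \<delta>] by (auto simp: Far_def)
  qed
  \<comment> \<open>\<open>S1\<close> is the pool of drivers to borrow from: since
    \<open>card S\<close> is at most \<open>k = card S1\<close>, it suffices for the near riders of
    \<open>S\<close> even after the far ones took theirs.\<close>
  have reroute: "cost2 d B S \<le> c + 4 * T"
    if "B \<subseteq> D" "S \<subseteq> R2" "card S \<le> k" "k \<le> card B" "0 \<le> c"
      and "serves d c B (S \<inter> Far) g" "serves d c B S1 h" for B S c g h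
  proof -
    have finSB: "finite S" "finite B" using that fin by (auto intro: finite_subset)
    have "card (S - Far) + card (S \<inter> Far) = card S"
      using finSB by (metis add.commute card_Int_Diff)
    then have "\<exists>f. serves d (c + 4 * T) B (S \<inter> Far \<union> (S - Far)) f"
      using that finSB finS near T0 S1_props
      by (intro serves_reroute[OF metric, where S = S1]) auto
    then obtain f where "serves d (c + 4 * T) B S f" by (auto simp: Int_Diff_Un)
    then show ?thesis using cost2_le[of B S "c + 4 * T" d f] that finSB T0 by auto
  qed

  define F1 where "F1 = S1 \<union> Far"
  have F1: "finite F1" "card F1 \<le> k + l"
    using finS Far card_Un_le[of S1 Far] S1_props card_Far by (auto simp: F1_def)
  \<comment> \<open>\<open>F1\<close> may have more than \<open>k\<close> riders, so it need not be
    a scenario itself; assignments for the two scenarios \<open>S1\<close> and \<open>Far\<close>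
    are glued, with \<open>disj\<close> giving injectivity.\<close>
  have opt_F1: "cost2 d A F1 \<le> T"
  proof -
    have "card Far \<le> k" using card_Far lk by simp
    then obtain g where g: "serves d T A Far g" using serve Far(1) by blast
    define f where "f r = (if r \<in> Far then g r else h r)" for r
    have fh: "f r = h r" if "r \<in> S1" for r
      using near_S1[OF that] that T0 by (simp add: f_def Far_def)
    have fg: "f r = g r" if "r \<in> Far" for r using that by (simp add: f_def)
    have images: "f ` S1 = h ` S1" "f ` Far = g ` Far" by (simp_all add: fh fg)
    have "inj_on f S1 \<longleftrightarrow> inj_on h S1" "inj_on f Far \<longleftrightarrow> inj_on g Far"
      by (rule inj_on_cong, simp add: fh, rule inj_on_cong, simp add: fg)
    then have "inj_on f S1" "inj_on f Far" using g h by (simp_all add: serves_def)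
    moreover have "f ` Far \<inter> f ` S1 = {}" unfolding images using disj[OF order_refl g] .
    then have "f ` (S1 - Far) \<inter> f ` (Far - S1) = {}" by blast
    ultimately have "inj_on f F1" by (simp add: F1_def inj_on_Un)
    then have "serves d T A F1 f"
      using g h by (auto simp: F1_def serves_def image_Un images fg fh)
    then show ?thesis using cost2_le[of A F1 T d f] A F1 T0 by simp
  qed
  have wc: "worst_cost2 d {S1, S2} D E = max (cost2 d (D - E) S1) (cost2 d (D - E) S2)" for E
    by (simp add: worst_cost2_def)
  have value_i: "cost1 d (Dsol i) R1 + worst_cost2 d {S1, S2} D (Dsol i) \<le> cost1 d Dopt R1 + 5 * T"
  proof -
    define B where "B = D - Dsol i"
    define c where "c = cost2 d B F1"
    have B: "finite B" "B \<subseteq> D" "card B = k + l"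
      using fin card_left[OF feas[OF il]] by (auto simp: B_def)
    \<comment> \<open>\<open>Dsol i\<close> is optimal for the single scenario \<open>F1\<close>,
      and \<open>Dopt\<close> is a competitor.\<close>
    have "cost1 d (Dsol i) R1 + c \<le> cost1 d Dopt R1 + cost2 d A F1"
      using Dsol[OF il] Dopt
      by (auto simp: one_scenario_solution_def is_arg_min_linorder c_def B_def A_def F1_def prefix)
    moreover have "card F1 \<le> card B" using B(3) F1(2) by simp
    then obtain f where f: "serves d c B F1 f"
      using obtain_cost2_serves[OF B(1) F1(1)] c_def by blast
    have c0: "0 \<le> c" using cost2_nonneg[of d B F1] B F1 c_def by simp
    have fS1: "serves d c B S1 f" using serves_mono[OF f order_refl] by (simp add: F1_def)
    then have "cost2 d B S1 \<le> c" using cost2_le[of B S1 c d f] B S1_props finS c0 by simp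
    \<comment> \<open>The far part of \<open>S2\<close> is already served within \<open>F1\<close>;
      its near part is rerouted through \<open>S1\<close>. With \<open>c\<close> replaced by
      \<open>T\<close> this yields the 5.\<close>
    moreover have "cost2 d B S2 \<le> c + 4 * T"
      using B S2_props lk c0 fS1 serves_mono[OF f order_refl, of "S2 \<inter> Far"]
      by (intro reroute[where g = f and h = f]) (auto simp: F1_def)
    ultimately show ?thesis using opt_F1 T0 wc[of "Dsol i"] by (simp add: B_def)
  qed

  define B where "B = D - D1"
  define w where "w = worst_cost2 d {S1, S2} D D1"
  have value_j: "cost1 d D1 R1 + w \<le> cost1 d Dopt R1 + 5 * T"
    using value_i j il by (force simp: is_arg_min_linorder D1 w_def)
  have B: "finite B" "B \<subseteq> D" "card B = k + l"
    using fin card_left[OF feas1] by (auto simp: B_def)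
  have w: "cost2 d B S1 \<le> w" "cost2 d B S2 \<le> w" by (auto simp: w_def wc B_def)
  have w0: "0 \<le> w" using w(1) cost2_nonneg[of d B S1] B finS S1_props by simp
  have small: "card S1 \<le> card B" "card S2 \<le> card B" using B(3) S1_props S2_props by simp_all
  obtain f1 where "serves d (cost2 d B S1) B S1 f1"
    using obtain_cost2_serves[OF B(1) finS(1) small(1)] by blast
  then have f1: "serves d w B S1 f1" using serves_mono w(1) by blast
  obtain f2 where f2: "serves d (cost2 d B S2) B S2 f2"
    using obtain_cost2_serves[OF B(1) finS(2) small(2)] by blast
  \<comment> \<open>Far riders of any scenario lie in \<open>S2\<close> and keep their drivers under
    \<open>f2\<close>; the others borrow drivers that \<open>f1\<close> gives to
    \<open>S1\<close>.\<close>
  have "cost2 d B S \<le> w + 4 * T" if "S \<subseteq> R2" "card S \<le> k" for S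
    using that B w0 f1 serves_mono[OF f2 w(2), of "S \<inter> Far"] Far_S2
    by (intro reroute[where g = f2 and h = f1]) auto
  then have "worst_cost2 d (budget_scenarios R2 k) D D1 \<le> w + 4 * T"
    using worst_cost2_budget_le_iff[OF fin(1)] by (simp add: B_def)
  then show "total_cost d R1 (budget_scenarios R2 k) D D1 \<le> cost1 d Dopt R1 + 9 * T"
    using value_j by (simp add: total_cost_def)
qed

section \<open>Passage to the stated constants\<close>

theorem theorem7:
  fixes d :: "'v \<Rightarrow> 'v \<Rightarrow> real"
    and R1 R2 D Dopt :: "'v set"
    and k :: nat
    and OPT1 OPT2 :: real
  assumes "finite R1" and "finite R2" and "finite D"
    and "Metric_space (R1 \<union> R2 \<union> D) d"
    and "card R1 + k \<le> card D"
    and "real k \<le> sqrt (real (card R2) / 2)"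
    and "surplus R1 k D < k"
    and "optimal_solution d R1 (budget_scenarios R2 k) D Dopt"
    and "OPT1 = cost1 d Dopt R1"
    and "OPT2 = worst_cost2 d (budget_scenarios R2 k) D Dopt"
  shows "(\<exists>D1. small_surplus_output d R1 R2 k D D1) \<and>
    (\<forall>D1. small_surplus_output d R1 R2 k D D1 \<longrightarrow>
      feasible R1 D D1 \<and>
      total_cost d R1 (budget_scenarios R2 k) D D1 \<le> 3 * OPT1 + 17 * OPT2)"
proof -
  have "(real k)\<^sup>2 \<le> (sqrt (real (card R2) / 2))\<^sup>2" using assms(6) by (intro power_mono) auto
  then have "real (2 * k\<^sup>2) \<le> real (card R2)" by simp
  then have k: "2 * k\<^sup>2 \<le> card R2" by (simp only: of_nat_le_iff)
  \<comment> \<open>Gives \<open>k \<le> card R2\<close>, so that \<open>k\<close> closest and, as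
    the surplus is below \<open>k\<close>, enough farthest riders exist.\<close>
  have "k \<le> k * k" by simp
  then have "k \<le> card R2" using k unfolding power2_eq_square by linarith
  then obtain D1 where "small_surplus_output d R1 R2 k D D1"
    using small_surplus_output_exists[of R2 D R1 k d] assms(2,3,5,7) by auto
  moreover have Dopt: "feasible R1 D Dopt"
    using assms(8) by (simp add: optimal_solution_def is_arg_min_def)
  \<comment> \<open>Nonnegativity of both costs lets the coefficients 1 and 9 be raised to 3 and
    17.\<close>
  moreover have "0 \<le> OPT1"
    using assms(9) cost1_nonneg[OF Metric_space.nonneg[OF assms(4)]] by simp
  moreover have "0 \<le> OPT2"
  proof -
    have "cost2 d (D - Dopt) {} \<le> OPT2"
      using worst_cost2_budget_le_iff[OF assms(2), of d k D Dopt OPT2] assms(10) by simp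
    then show ?thesis by (simp add: cost2_def)
  qed
  moreover note small_surplus_bound[OF assms(2-5) k assms(7) Dopt assms(10)]
  ultimately show ?thesis using assms(9) by fastforce
qed

end
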